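(* Let $X$ be a completely regular space. The following are equivalent: (1) $X$ is pseudocompactness-connected, i.e. $\mathscr{P}$-connected where $\mathscr{P}$ is pseudocompactness. (2) The subspace $\mathrm{cl}_{\beta X}(\beta X\setminus\upsilon X)$ of $\beta X$ is connected.
   Context: Completely regular spaces are taken to be Hausdorff (i.e. Tychonoff). A completely regular space is pseudocompact if every continuous real-valued function on it is bounded. A zero-set of a space $X$ is a set $f^{-1}(0)$ with $f:X\to[0,1]$ continuous; a cozero-set of $X$ is the complement in $X$ of a zero-set. $\mathrm{Coz}(X)$ denotes the set of all cozero-sets of $X$. Let $\mathscr{P}$ be a topological property. A $\mathscr{P}$-separation for a space $X$ is a pair $C,D\in\mathrm{Coz}(X)$ such that: $C$ and $D$ are disjoint; neither $\mathrm{cl}_XC$ nor $\mathrm{cl}_XD$ has $\mathscr{P}$; and $X\setminus(C\cup D)\subseteq E$ for some $E\in\mathrm{Coz}(X)$ such that $\mathrm{cl}_XE$ has $\mathscr{P}$. The space $X$ is $\mathscr{P}$-disconnected if there is a $\mathscr{P}$-separation for it, and $\mathscr{P}$-connected otherwise. $\beta X$ is the Stone–Čech compactification of $X$, and $\upsilon X$ is the Hewitt realcompactification of $X$, regarded as a subspace $X\subseteq\upsilon X\subseteq\beta X$; it is the intersection of all cozero-sets of $\beta X$ containing $X$. A space is connected if it is not the union of two disjoint non-empty closed subsets; in particular the empty space is connected. *)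

theory Defs
  imports "HOL-Analysis.Analysis"
begin

section \<open>Zero-sets and cozero-sets\<close>

definition zero_set_in :: "'a topology \<Rightarrow> 'a set \<Rightarrow> bool" where
  "zero_set_in X Z \<longleftrightarrow>
     (\<exists>f. continuous_map X (top_of_set {0..1::real}) f \<and> Z = {x \<in> topspace X. f x = 0})"

definition Coz :: "'a topology \<Rightarrow> 'a set set" where
  "Coz X = {topspace X - Z | Z. zero_set_in X Z}"


section \<open>Separations relative to a topological property\<close>

text \<open>A topological property is rendered as a predicate on topologies; a subset of a space
  has the property when the corresponding subspace does.\<close>

definition P_separation :: "('a topology \<Rightarrow> bool) \<Rightarrow> 'a topology \<Rightarrow> 'a set \<Rightarrow> 'a set \<Rightarrow> bool" where
  "P_separation P X C D \<longleftrightarrow>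
     C \<in> Coz X \<and> D \<in> Coz X \<and> C \<inter> D = {} \<and>
     \<not> P (subtopology X (X closure_of C)) \<and>
     \<not> P (subtopology X (X closure_of D)) \<and>
     (\<exists>E \<in> Coz X. topspace X - (C \<union> D) \<subseteq> E \<and> P (subtopology X (X closure_of E)))"

definition P_disconnected :: "('a topology \<Rightarrow> bool) \<Rightarrow> 'a topology \<Rightarrow> bool" where
  "P_disconnected P X \<longleftrightarrow> (\<exists>C D. P_separation P X C D)"

definition P_connected :: "('a topology \<Rightarrow> bool) \<Rightarrow> 'a topology \<Rightarrow> bool" where
  "P_connected P X \<longleftrightarrow> \<not> P_disconnected P X"

definition pseudocompact_space :: "'a topology \<Rightarrow> bool" where
  "pseudocompact_space X \<longleftrightarrow>
     completely_regular_space X \<and> Hausdorff_space X \<and>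
     (\<forall>f. continuous_map X euclideanreal f \<longrightarrow> bounded (f ` topspace X))"


section \<open>The Stone-Cech compactification\<close>

text \<open>The space is mapped by evaluation into the cube whose coordinates are the continuous
  functions from \<open>X\<close> to the unit interval, and \<open>\<beta>X\<close> is the closure of the image. Functions are
  taken extensional so that each continuous function on the carrier indexes exactly one
  coordinate. The lemmas below show that, for Tychonoff \<open>X\<close>, this is a Hausdorff
  compactification of \<open>X\<close> with the extension property that characterizes \<open>\<beta>X\<close>.\<close>

definition unit_maps :: "'a topology \<Rightarrow> ('a \<Rightarrow> real) set" where
  "unit_maps X = {f \<in> extensional (topspace X). continuous_map X (top_of_set {0..1}) f}"

definition unit_cube :: "'a topology \<Rightarrow> (('a \<Rightarrow> real) \<Rightarrow> real) topology" where
  "unit_cube X = product_topology (\<lambda>_. top_of_set {0..1}) (unit_maps X)"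

definition beta_embed :: "'a topology \<Rightarrow> 'a \<Rightarrow> ('a \<Rightarrow> real) \<Rightarrow> real" where
  "beta_embed X x = (\<lambda>f \<in> unit_maps X. f x)"

definition beta_space :: "'a topology \<Rightarrow> (('a \<Rightarrow> real) \<Rightarrow> real) topology" where
  "beta_space X = subtopology (unit_cube X) (unit_cube X closure_of (beta_embed X ` topspace X))"

text \<open>The point set of the Hewitt realcompactification, as a subset of \<open>\<beta>X\<close>.\<close>

definition upsilon_set :: "'a topology \<Rightarrow> (('a \<Rightarrow> real) \<Rightarrow> real) set" where
  "upsilon_set X = \<Inter> {U \<in> Coz (beta_space X). beta_embed X ` topspace X \<subseteq> U}"


lemma unit_maps_eq:
  fixes X :: "'a topology"
  shows "unit_maps X = mspace (submetric (cfunspace X euclidean_metric) {f. f \<in> topspace X \<rightarrow> {0..1}})"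
proof (intro set_eqI iffI)
  fix f :: "'a \<Rightarrow> real"
  assume "f \<in> unit_maps X"
  then have "f \<in> extensional (topspace X)" "continuous_map X euclideanreal f"
    and f: "f \<in> topspace X \<rightarrow> {0..1}"
    by (simp_all add: unit_maps_def continuous_map_in_subtopology image_subset_iff_funcset)
  moreover have "bounded (f ` topspace X)"
    using f by (intro bounded_subset [OF bounded_closed_interval [of 0 1]]) auto
  ultimately show "f \<in> mspace (submetric (cfunspace X euclidean_metric) {f. f \<in> topspace X \<rightarrow> {0..1}})"
    by simp
next
  fix f :: "'a \<Rightarrow> real"
  assume "f \<in> mspace (submetric (cfunspace X euclidean_metric) {f. f \<in> topspace X \<rightarrow> {0..1}})"
  then show "f \<in> unit_maps X"
    by (simp add: unit_maps_def continuous_map_in_subtopology image_subset_iff_funcset)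
qed

lemma embedding_map_unit_cube:
  assumes "completely_regular_space X" "Hausdorff_space X"
  shows "embedding_map X (unit_cube X) (beta_embed X)"
  using completely_regular_space_cube_embedding_explicit [OF assms]
  by (simp add: unit_cube_def beta_embed_def [abs_def] unit_maps_eq)

lemma beta_embed_in_cube: "beta_embed X ` topspace X \<subseteq> topspace (unit_cube X)"
proof -
  have "f x \<in> {0..1}" if "x \<in> topspace X" "f \<in> unit_maps X" for x f
    using that unfolding unit_maps_def continuous_map_in_subtopology by blast
  then show ?thesis
    unfolding unit_cube_def beta_embed_def topspace_product_topology by auto
qed

lemma beta_embed_in_closure:
  "beta_embed X ` topspace X \<subseteq> unit_cube X closure_of (beta_embed X ` topspace X)"
  by (simp add: beta_embed_in_cube closure_of_subset)

lemma topspace_beta_space: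
  "topspace (beta_space X) = unit_cube X closure_of (beta_embed X ` topspace X)"
  using closure_of_subset_topspace [of "unit_cube X"] by (auto simp: beta_space_def)

lemma embedding_map_beta_space:
  assumes "completely_regular_space X" "Hausdorff_space X"
  shows "embedding_map X (beta_space X) (beta_embed X)"
  using embedding_map_unit_cube [OF assms] beta_embed_in_closure [of X]
  by (simp add: beta_space_def embedding_map_in_subtopology image_subset_iff_funcset)

lemma compact_space_beta_space: "compact_space (beta_space X)"
proof -
  have "compact_space (unit_cube X)"
    by (simp add: unit_cube_def compact_space_product_topology compact_space_subtopology)
  then show ?thesis
    by (simp add: beta_space_def closedin_compact_space compact_space_subtopology)
qed

lemma Hausdorff_space_beta_space: "Hausdorff_space (beta_space X)"
  by (simp add: beta_space_def unit_cube_def Hausdorff_space_subtopology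
      Hausdorff_space_product_topology)

lemma dense_beta_space:
  "beta_space X closure_of (beta_embed X ` topspace X) = topspace (beta_space X)"
  unfolding topspace_beta_space
  using beta_embed_in_closure [of X] by (simp add: beta_space_def closure_of_subtopology Int_absorb1)

lemma beta_space_extension:
  assumes "continuous_map X (top_of_set {0..1::real}) f"
  obtains g where "continuous_map (beta_space X) (top_of_set {0..1}) g"
    "\<And>x. x \<in> topspace X \<Longrightarrow> g (beta_embed X x) = f x"
proof
  let ?f = "restrict f (topspace X)"
  have "continuous_map X (top_of_set {0..1}) ?f"
    by (rule continuous_map_eq [OF assms]) simp
  then have f: "?f \<in> unit_maps X"
    by (simp add: unit_maps_def)
  then show "continuous_map (beta_space X) (top_of_set {0..1}) (\<lambda>p. p ?f)"
    unfolding beta_space_def unit_cube_def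
    by (intro continuous_map_from_subtopology continuous_map_product_projection)
  show "beta_embed X x ?f = f x" if "x \<in> topspace X" for x
    using f that by (simp add: beta_embed_def)
qed

end

theory Submission
  imports Defs
begin

text \<open>Write \<open>B = \<beta>X\<close> and \<open>W = \<beta>X - \<upsilon>X\<close>. For a cozero-set \<open>U\<close> of \<open>X\<close>, the closure of \<open>U\<close> in \<open>X\<close> is
  pseudocompact iff the closure of \<open>U\<close> in \<open>B\<close> misses \<open>W\<close>: a point of \<open>W\<close> in that closure is a zero
  of some \<open>f\<close> that is positive on \<open>X\<close>, so \<open>1/f\<close> is unbounded on \<open>U\<close>; conversely, an unbounded
  function on the closure of \<open>U\<close> yields \<open>g \<ge> 0\<close> on \<open>X\<close> unbounded on \<open>U\<close>, and the extension of
  \<open>1/(1+g)\<close> to \<open>B\<close> vanishes at a point of \<open>W\<close> in the closure of \<open>U\<close>.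

  If \<open>cl W\<close> splits into two closed pieces, the level sets of a Urysohn function separating them give
  a separation of \<open>X\<close>. If \<open>C\<close>, \<open>D\<close>, \<open>E\<close> form a separation, then \<open>C - E\<close> and \<open>D - E\<close> are disjoint
  zero-sets of \<open>X\<close> and so have disjoint closures in \<open>B\<close>; as \<open>cl E\<close> misses \<open>W\<close>, these closures cover
  \<open>cl W\<close>, and both meet it.\<close>

section \<open>Cozero-sets given by real-valued functions\<close>

lemma in_Coz_iff:
  "U \<in> Coz X \<longleftrightarrow>
     (\<exists>f. continuous_map X (top_of_set {0..1::real}) f \<and> U = {x \<in> topspace X. f x \<noteq> 0})"
proof -
  have "topspace X - {x \<in> topspace X. f x = 0} = {x \<in> topspace X. f x \<noteq> 0}" for f :: "'a \<Rightarrow> real"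
    by blast
  then show ?thesis
    unfolding Coz_def zero_set_in_def by auto
qed

lemma CozE:
  assumes "U \<in> Coz X"
  obtains c where "continuous_map X euclideanreal c" "\<And>x. x \<in> topspace X \<Longrightarrow> 0 \<le> c x \<and> c x \<le> 1"
    "U = {x \<in> topspace X. c x \<noteq> 0}"
proof -
  obtain c where c: "continuous_map X (top_of_set {0..1::real}) c" "U = {x \<in> topspace X. c x \<noteq> 0}"
    using assms by (auto simp: in_Coz_iff)
  show ?thesis
  proof
    show "continuous_map X euclideanreal c" "U = {x \<in> topspace X. c x \<noteq> 0}"
      using c by (auto simp: continuous_map_in_subtopology)
    show "0 \<le> c x \<and> c x \<le> 1" if "x \<in> topspace X" for x
      using c(1) that by (force simp: continuous_map_in_subtopology)
  qed
qed

text \<open>The truncation \<open>min 1 (max 0 (f x))\<close> vanishes exactly where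
  \<open>f x \<le> 0\<close>.\<close>

lemma positive_set_in_Coz:
  assumes "continuous_map X euclideanreal f"
  shows "{x \<in> topspace X. 0 < f x} \<in> Coz X"
proof -
  have "continuous_map X (top_of_set {0..1::real}) (\<lambda>x. min 1 (max 0 (f x)))"
    unfolding continuous_map_in_subtopology
    using assms by (auto intro!: continuous_intros)
  moreover have "{x \<in> topspace X. 0 < f x} = {x \<in> topspace X. min 1 (max 0 (f x)) \<noteq> 0}"
    by (auto simp: min_def max_def)
  ultimately show ?thesis
    unfolding in_Coz_iff by blast
qed

section \<open>Unbounded continuous functions on closures of cozero-sets\<close>

text \<open>A sequence in \<open>Y\<close> with gaps above 1 has a closed discrete range, on which
  any \<open>a\<close>, however irregular, is continuous; Tietze's theorem extends it to the
  line.\<close>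

lemma continuous_interpolation_unbounded:
  fixes Y :: "real set" and a :: "real \<Rightarrow> real"
  assumes "\<And>t. \<exists>y\<in>Y. t < y"
  obtains \<phi> where "continuous_on UNIV \<phi>" "\<And>t. \<exists>y\<in>Y. t < y \<and> \<phi> y = a y"
proof -
  obtain s where s: "\<And>t. s t \<in> Y" "\<And>t. t < s t"
    using assms by metis
  \<comment> \<open>Applying \<open>s\<close> to \<open>t + 1\<close> rather than \<open>t\<close>
    makes successive terms differ by more than 1.\<close>
  define y where "y = (\<lambda>n. ((\<lambda>t. s (t + 1)) ^^ n) (s 0))"
  have ySuc: "y (Suc n) = s (y n + 1)" for n
    by (simp add: y_def)
  have yY: "y n \<in> Y" for n
    by (cases n) (auto simp: y_def s)
  have step: "y n + 1 < y (Suc n)" for n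
    using s(2) ySuc by simp
  have large: "real n \<le> y n" for n
  proof (induction n)
    case 0
    show ?case using s(2) [of 0] by (simp add: y_def)
  next
    case (Suc n)
    then show ?case using step [of n] by simp
  qed
  have mono: "strict_mono y"
    using step by (intro strict_mono_Suc_iff [THEN iffD2]) (smt (verit))
  have gap: "y m + 1 < y n" if "m < n" for m n
  proof -
    have "y (Suc m) \<le> y n"
      using mono that by (simp add: strict_mono_less_eq)
    then show ?thesis
      using step [of m] by simp
  qed
  have discrete: "v = u" if "u \<in> range y" "v \<in> range y" "dist v u < 1" for u v
  proof -
    obtain m n where mn: "u = y m" "v = y n"
      using \<open>u \<in> range y\<close> \<open>v \<in> range y\<close> by blast
    then show ?thesis
      using gap [of m n] gap [of n m] that(3)
      by (cases m n rule: linorder_cases) (auto simp: dist_real_def)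
  qed
  have "closed (range y)"
    by (rule discrete_imp_closed [OF zero_less_one]) (intro ballI impI discrete)
  moreover have "continuous_on (range y) a"
    unfolding continuous_on_iff
  proof (intro ballI allI impI)
    fix u e :: real
    assume "u \<in> range y" "0 < e"
    then have "dist (a v) (a u) < e" if "v \<in> range y" "dist v u < 1" for v
      using discrete [of u v] that by simp
    then show "\<exists>d>0. \<forall>v\<in>range y. dist v u < d \<longrightarrow> dist (a v) (a u) < e"
      using zero_less_one by blast
  qed
  ultimately obtain \<phi> where \<phi>: "continuous_on UNIV \<phi>" "\<And>v. v \<in> range y \<Longrightarrow> \<phi> v = a v"
    using Tietze_unbounded [of "range y" a UNIV] by auto
  show ?thesis
  proof
    show "\<exists>y\<in>Y. t < y \<and> \<phi> y = a y" for t
    proof -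
      obtain n where "t < real n"
        using reals_Archimedean2 by blast
      then show ?thesis
        using large [of n] yY \<phi>(2) by (intro bexI [of _ "y n"]) auto
    qed
  qed (fact \<phi>(1))
qed

text \<open>Since \<open>h\<close> itself need not extend to \<open>X\<close>, it is damped so as to
  vanish on the frontier of the closure of \<open>U\<close>, yet stays large at suitable points of
  \<open>U\<close>; outside the closure it is continued by 0.\<close>

lemma unbounded_on_Coz_extension:
  fixes h :: "'a \<Rightarrow> real"
  assumes U: "U \<in> Coz X"
    and h: "continuous_map (subtopology X (X closure_of U)) euclideanreal h"
    and unbounded: "\<not> bounded (h ` (X closure_of U))"
  obtains g where "continuous_map X euclideanreal g" "\<And>x. x \<in> topspace X \<Longrightarrow> 0 \<le> g x"
    "\<And>t. \<exists>x\<in>U. t < g x"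
proof -
  let ?A = "X closure_of U"
  obtain c where c: "continuous_map X euclideanreal c" "\<And>x. x \<in> topspace X \<Longrightarrow> 0 \<le> c x \<and> c x \<le> 1"
    and Ueq: "U = {x \<in> topspace X. c x \<noteq> 0}"
    using U by (rule CozE) blast
  have UA: "U \<subseteq> ?A"
    using Ueq by (intro closure_of_subset) auto
  have A: "closedin X ?A" "?A \<subseteq> topspace X"
    by (auto simp: closure_of_subset_topspace)
  have absh: "continuous_map (subtopology X ?A) euclideanreal (\<lambda>x. \<bar>h x\<bar>)"
    using h by (intro continuous_intros)
  \<comment> \<open>A bound on \<open>U\<close> would persist on its closure, so the unboundedness
    of \<open>h\<close> is already visible on \<open>U\<close>.\<close>
  have "\<exists>y\<in>(\<lambda>x. \<bar>h x\<bar>) ` U. t < y" for t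
  proof (rule ccontr)
    assume "\<not> ?thesis"
    then have le: "\<bar>h x\<bar> \<le> t" if "x \<in> U" for x
      using that by auto
    have "closedin (subtopology X ?A) {x \<in> topspace (subtopology X ?A). \<bar>h x\<bar> \<in> {..t}}"
      by (intro closedin_continuous_map_preimage [OF absh]) simp
    then have "closedin X {x \<in> topspace X. x \<in> ?A \<and> \<bar>h x\<bar> \<le> t}"
      using A by (auto simp: closedin_closed_subtopology elim!: back_subst [of "closedin X"])
    then have "x \<in> ?A \<and> \<bar>h x\<bar> \<le> t" if "x \<in> ?A" for x
      using forall_in_closure_of [OF that, of "\<lambda>x. x \<in> ?A \<and> \<bar>h x\<bar> \<le> t"] le UA by blast
    then show False
      using unbounded by (auto simp: bounded_iff)
  qed
  \<comment> \<open>\<open>\<phi>\<close> sees only the value \<open>y\<close> of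
    \<open>\<bar>h x\<bar>\<close>, whereas \<open>c\<close> may vary on that level set, so
    \<open>SOME\<close> fixes one point of \<open>U\<close> per value.\<close>
  then obtain \<phi> where \<phi>: "continuous_on UNIV \<phi>"
    and \<phi>a: "\<And>t. \<exists>y\<in>(\<lambda>x. \<bar>h x\<bar>) ` U. t < y \<and> \<phi> y = 1 / c (SOME x. x \<in> U \<and> \<bar>h x\<bar> = y)"
    using continuous_interpolation_unbounded [of "(\<lambda>x. \<bar>h x\<bar>) ` U" "\<lambda>y. 1 / c (SOME x. x \<in> U \<and> \<bar>h x\<bar> = y)"]
    by blast
  text \<open>The factor \<open>c x\<close> makes \<open>q\<close> vanish on the boundary of the closure of \<open>U\<close>, while \<open>\<phi>\<close> undoes it
    along a sequence in \<open>U\<close> on which \<open>h\<close> is unbounded.\<close>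
  define q where "q = (\<lambda>x. min 1 (c x * \<bar>\<phi> \<bar>h x\<bar>\<bar>) * \<bar>h x\<bar>)"
  have \<phi>h: "continuous_map (subtopology X ?A) euclideanreal (\<lambda>x. \<phi> \<bar>h x\<bar>)"
    using continuous_map_compose [OF absh, of euclideanreal \<phi>] \<phi> by (simp add: o_def)
  have q: "continuous_map (subtopology X ?A) euclideanreal q"
    unfolding q_def using h c(1) \<phi>h
    by (intro continuous_intros) (auto intro: continuous_map_from_subtopology)
  show ?thesis
  proof
    show "continuous_map X euclideanreal (\<lambda>x. if x \<in> ?A then q x else 0)"
    proof (rule continuous_map_cases)
      show "continuous_map (subtopology X (X closure_of {x. x \<in> ?A})) euclideanreal q"
        using q by simp
      show "q x = 0" if "x \<in> X frontier_of {x. x \<in> ?A}" for x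
      proof -
        \<comment> \<open>\<open>c\<close> is 0 off \<open>U\<close>, hence off the closure of
          \<open>U\<close>, and by continuity also on the frontier.\<close>
        have "x \<in> X closure_of (topspace X - ?A)"
          using that by (simp add: frontier_of_closures)
        moreover have "closedin X {x \<in> topspace X. c x \<in> {0}}"
          by (rule closedin_continuous_map_preimage [OF c(1)]) simp
        moreover have "c z \<in> {0}" if "z \<in> topspace X - ?A" for z
          using that UA Ueq by blast
        ultimately have "c x \<in> {0}"
          using forall_in_closure_of [of x X "topspace X - ?A" "\<lambda>x. c x \<in> {0}"] by blast
        then show ?thesis
          by (simp add: q_def)
      qed
    qed auto
    show "0 \<le> (if x \<in> ?A then q x else 0)" if "x \<in> topspace X" for x
      using c(2) [OF that] by (simp add: q_def)
    show "\<exists>x\<in>U. t < (if x \<in> ?A then q x else 0)" for t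
    proof -
      obtain y where y: "y \<in> (\<lambda>x. \<bar>h x\<bar>) ` U" "t < y" "\<phi> y = 1 / c (SOME x. x \<in> U \<and> \<bar>h x\<bar> = y)"
        using \<phi>a by blast
      define x where "x = (SOME x. x \<in> U \<and> \<bar>h x\<bar> = y)"
      have x: "x \<in> U \<and> \<bar>h x\<bar> = y"
        unfolding x_def by (rule someI_ex) (use y in auto)
      then have "c x > 0"
        using Ueq c(2) [of x] by auto
      \<comment> \<open>At the chosen point \<open>c x * \<phi> y = 1\<close>, so the minimum in
        \<open>q\<close> equals 1 and nothing is damped.\<close>
      then have "q x = y"
        using x y(3) by (simp add: q_def flip: x_def)
      then show ?thesis
        using x y(2) UA by auto
    qed
  qed
qed

section \<open>Pseudocompact closures and the points of \<beta>X outside \<upsilon>X\<close>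

lemma continuous_map_beta_embed: "continuous_map X (beta_space X) (beta_embed X)"
proof -
  have "continuous_map X (unit_cube X) (beta_embed X)"
    unfolding unit_cube_def continuous_map_componentwise beta_embed_def
    by (auto simp: unit_maps_def)
  then show ?thesis
    using beta_embed_in_closure [of X]
    by (simp add: beta_space_def continuous_map_in_subtopology image_subset_iff_funcset)
qed

text \<open>The nonzero set of \<open>f\<close> is one of the cozero-sets intersected in
  \<open>upsilon_set X\<close>, and it omits \<open>p\<close>.\<close>

lemma notin_upsilon_set:
  assumes "continuous_map (beta_space X) (top_of_set {0..1::real}) f" "p \<in> topspace (beta_space X)" "f p = 0"
    "\<And>x. x \<in> topspace X \<Longrightarrow> f (beta_embed X x) \<noteq> 0"
  shows "p \<notin> upsilon_set X"
proof -
  let ?U = "{p \<in> topspace (beta_space X). f p \<noteq> 0}"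
  have "?U \<in> Coz (beta_space X)"
    using assms(1) unfolding in_Coz_iff by blast
  moreover have "beta_embed X ` topspace X \<subseteq> ?U"
    using assms(4) continuous_map_image_subset_topspace [OF continuous_map_beta_embed [of X]] by blast
  ultimately show ?thesis
    using assms(3) unfolding upsilon_set_def by blast
qed

text \<open>For \<open>f\<close> positive on the image of \<open>X\<close>, a bound \<open>M\<close>
  on \<open>1 / f\<close> over the image of \<open>A\<close> keeps \<open>f\<close> at least
  \<open>1 / M\<close> there and so on the closure, which then contains no zero of
  \<open>f\<close>.\<close>

lemma pseudocompact_imp_closure_subset_upsilon_set:
  assumes "pseudocompact_space (subtopology X A)" and "A \<subseteq> topspace X"
  shows "beta_space X closure_of (beta_embed X ` A) \<subseteq> upsilon_set X"
proof
  fix p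
  assume p: "p \<in> beta_space X closure_of (beta_embed X ` A)"
  then have pB: "p \<in> topspace (beta_space X)"
    by (simp add: in_closure_of)
  show "p \<in> upsilon_set X"
  proof (rule ccontr)
    assume "p \<notin> upsilon_set X"
    then obtain V where V: "V \<in> Coz (beta_space X)" "beta_embed X ` topspace X \<subseteq> V" "p \<notin> V"
      by (auto simp: upsilon_set_def)
    obtain f where f: "continuous_map (beta_space X) euclideanreal f"
      "\<And>q. q \<in> topspace (beta_space X) \<Longrightarrow> 0 \<le> f q \<and> f q \<le> 1"
      and Veq: "V = {q \<in> topspace (beta_space X). f q \<noteq> 0}"
      using V(1) by (rule CozE) blast
    have pos: "0 < f (beta_embed X x)" if "x \<in> topspace X" for x
    proof -
      have "beta_embed X x \<in> V"
        using V(2) that by auto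
      then show ?thesis
        using Veq f(2) [of "beta_embed X x"] by auto
    qed
    have "continuous_map X euclideanreal (\<lambda>x. f (beta_embed X x))"
      using continuous_map_compose [OF continuous_map_beta_embed f(1)] by (simp add: o_def)
    then have "continuous_map (subtopology X A) euclideanreal (\<lambda>x. 1 / f (beta_embed X x))"
      using pos by (intro continuous_intros) (fastforce intro: continuous_map_from_subtopology)+
    then have "bounded ((\<lambda>x. 1 / f (beta_embed X x)) ` A)"
      using assms by (auto simp: pseudocompact_space_def Int_absorb1)
    then obtain M where M: "0 < M" "\<And>x. x \<in> A \<Longrightarrow> \<bar>1 / f (beta_embed X x)\<bar> \<le> M"
      unfolding bounded_pos by auto
    have "closedin (beta_space X) {q \<in> topspace (beta_space X). f q \<in> {1/M..}}"
      by (intro closedin_continuous_map_preimage [OF f(1)]) simp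
    moreover have "1 / M \<le> f (beta_embed X x)" if "x \<in> A" for x
    proof -
      have "0 < f (beta_embed X x)"
        using pos that assms(2) by auto
      then show ?thesis
        using M(2) [OF that] M(1) by (simp add: field_simps)
    qed
    ultimately have "1 / M \<le> f p"
      by (intro forall_in_closure_of [OF p, of "\<lambda>q. 1 / M \<le> f q"]) auto
    then show False
      using M(1) V(3) pB Veq by (smt (verit) mem_Collect_eq divide_pos_pos)
  qed
qed

text \<open>Translates each pseudocompactness clause of a separation into a statement about closures
  in \<beta>X. From right to left, that \<open>U\<close> is a cozero-set lets an unbounded function
  on its closure be replaced by one on all of \<open>X\<close>.\<close>

lemma pseudocompact_closure_of_Coz_iff:
  assumes X: "completely_regular_space X" "Hausdorff_space X" and U: "U \<in> Coz X"
  shows "pseudocompact_space (subtopology X (X closure_of U)) \<longleftrightarrow>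
    beta_space X closure_of (beta_embed X ` U) \<subseteq> upsilon_set X"
proof -
  let ?A = "X closure_of U"
  have A: "?A \<subseteq> topspace X"
    by (simp add: closure_of_subset_topspace)
  have UX: "U \<subseteq> topspace X"
    using U by (auto simp: in_Coz_iff)
  show ?thesis
  proof
    assume "pseudocompact_space (subtopology X ?A)"
    then have "beta_space X closure_of (beta_embed X ` ?A) \<subseteq> upsilon_set X"
      using A by (rule pseudocompact_imp_closure_subset_upsilon_set)
    moreover have "beta_embed X ` U \<subseteq> beta_embed X ` ?A"
      using UX closure_of_subset by blast
    ultimately show "beta_space X closure_of (beta_embed X ` U) \<subseteq> upsilon_set X"
      using closure_of_mono by blast
  next
    assume sub: "beta_space X closure_of (beta_embed X ` U) \<subseteq> upsilon_set X"
    have False if h: "continuous_map (subtopology X ?A) euclideanreal h" "\<not> bounded (h ` ?A)" for h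
    proof -
      obtain g where g: "continuous_map X euclideanreal g" "\<And>x. x \<in> topspace X \<Longrightarrow> 0 \<le> g x"
        "\<And>t. \<exists>x\<in>U. t < g x"
        using unbounded_on_Coz_extension [OF U h] by blast
      have g1: "0 < 1 + g x" if "x \<in> topspace X" for x
        using g(2) [OF that] by simp
      \<comment> \<open>The values lie between 0 and 1, so the function extends to \<beta>X, and
        they become arbitrarily small on \<open>U\<close>.\<close>
      have "continuous_map X euclideanreal (\<lambda>x. 1 / (1 + g x))"
        using g(1) g1 by (intro continuous_intros) (auto simp: less_le)
      then have "continuous_map X (top_of_set {0..1}) (\<lambda>x. 1 / (1 + g x))"
        using g(2) g1 by (auto simp: continuous_map_in_subtopology field_simps)
      then obtain \<Gamma> where \<Gamma>: "continuous_map (beta_space X) (top_of_set {0..1}) \<Gamma>"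
        and \<Gamma>eq: "\<And>x. x \<in> topspace X \<Longrightarrow> \<Gamma> (beta_embed X x) = 1 / (1 + g x)"
        by (rule beta_space_extension) blast
      let ?K = "beta_space X closure_of (beta_embed X ` U)"
      \<comment> \<open>Compactness makes the image of \<open>?K\<close> closed, so the limit value
        0 is attained at a point of \<open>?K\<close>.\<close>
      have "compactin (beta_space X) ?K"
        by (simp add: closedin_compact_space compact_space_beta_space)
      then have "compactin euclideanreal (\<Gamma> ` ?K)"
        using \<Gamma> by (intro image_compactin) (auto simp: continuous_map_in_subtopology)
      then have "closed (\<Gamma> ` ?K)"
        by (simp add: compact_imp_closed)
      moreover have "0 \<in> closure (\<Gamma> ` ?K)"
        unfolding closure_approachable
      proof (intro allI impI)
        fix e :: real
        assume "0 < e"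
        obtain x where x: "x \<in> U" "1 / e < g x"
          using g(3) by blast
        then have xX: "x \<in> topspace X"
          using UX by blast
        have "1 < e * (1 + g x)"
          using x(2) \<open>0 < e\<close> by (simp add: field_simps)
        then have "1 / (1 + g x) < e"
          using g1 [OF xX] by (simp add: field_simps)
        then have "dist (\<Gamma> (beta_embed X x)) 0 < e"
          unfolding \<Gamma>eq [OF xX] using g1 [OF xX] by simp
        moreover have "beta_embed X x \<in> ?K"
          using x(1) UX continuous_map_image_subset_topspace [OF continuous_map_beta_embed [of X]]
            closure_of_subset [of "beta_embed X ` U" "beta_space X"] by blast
        ultimately show "\<exists>v\<in>\<Gamma> ` ?K. dist v 0 < e"
          by blast
      qed
      ultimately obtain p where p: "p \<in> ?K" "\<Gamma> p = 0"
        by (metis closure_closed imageE)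
      have "p \<in> topspace (beta_space X)"
        using p(1) by (simp add: in_closure_of)
      moreover have "\<Gamma> (beta_embed X x) \<noteq> 0" if "x \<in> topspace X" for x
        using \<Gamma>eq [OF that] g1 [OF that] by simp
      ultimately have "p \<notin> upsilon_set X"
        using \<Gamma> p(2) by (intro notin_upsilon_set)
      then show False
        using p(1) sub by blast
    qed
    then show "pseudocompact_space (subtopology X ?A)"
      using X A by (auto simp: pseudocompact_space_def completely_regular_space_subtopology
          Hausdorff_space_subtopology Int_absorb1)
  qed
qed

section \<open>From a separation of \<open>X\<close> to a disconnection in \<beta>X\<close>

lemma P_disconnected_imp_not_connectedin:
  assumes X: "completely_regular_space X" "Hausdorff_space X"
    and sep: "P_separation pseudocompact_space X C D"
  shows "\<not> connectedin (beta_space X)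
    (beta_space X closure_of (topspace (beta_space X) - upsilon_set X))"
proof
  let ?B = "beta_space X" and ?e = "beta_embed X"
  let ?W = "topspace ?B - upsilon_set X"
  let ?K = "?B closure_of ?W"
  assume conn: "connectedin ?B ?K"
  obtain E where CDE: "C \<in> Coz X" "D \<in> Coz X" "C \<inter> D = {}" "E \<in> Coz X"
    and cover: "topspace X - (C \<union> D) \<subseteq> E"
    and npc: "\<not> pseudocompact_space (subtopology X (X closure_of C))"
      "\<not> pseudocompact_space (subtopology X (X closure_of D))"
    and pE: "pseudocompact_space (subtopology X (X closure_of E))"
    using sep unfolding P_separation_def by blast
  obtain c where c: "continuous_map X euclideanreal c" "\<And>x. x \<in> topspace X \<Longrightarrow> 0 \<le> c x \<and> c x \<le> 1"
    and Ceq: "C = {x \<in> topspace X. c x \<noteq> 0}"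
    using CDE(1) by (rule CozE) blast
  obtain d where d: "continuous_map X euclideanreal d" "\<And>x. x \<in> topspace X \<Longrightarrow> 0 \<le> d x \<and> d x \<le> 1"
    and Deq: "D = {x \<in> topspace X. d x \<noteq> 0}"
    using CDE(2) by (rule CozE) blast
  obtain r where r: "continuous_map X euclideanreal r" "\<And>x. x \<in> topspace X \<Longrightarrow> 0 \<le> r x \<and> r x \<le> 1"
    and Eeq: "E = {x \<in> topspace X. r x \<noteq> 0}"
    using CDE(4) by (rule CozE) blast
  \<comment> \<open>The zero-sets of \<open>r + d\<close> and \<open>r + c\<close> are
    \<open>C - E\<close> and \<open>D - E\<close>, since \<open>C\<close>, \<open>D\<close>,
    \<open>E\<close> cover \<open>X\<close>; the quotient is thus 0 on the first and 1 on the
    second.\<close>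
  define \<phi> where "\<phi> = (\<lambda>x. (r x + d x) / ((r x + d x) + (r x + c x)))"
  have pos: "0 < (r x + d x) + (r x + c x)" if "x \<in> topspace X" for x
  proof -
    have "c x \<noteq> 0 \<or> d x \<noteq> 0 \<or> r x \<noteq> 0"
      using that cover Ceq Deq Eeq by blast
    then show ?thesis
      using c(2) d(2) r(2) that by (smt (verit))
  qed
  have "continuous_map X euclideanreal \<phi>"
    unfolding \<phi>_def using c(1) d(1) r(1) pos
    by (intro continuous_intros) (auto simp: less_le)
  moreover have "0 \<le> \<phi> x \<and> \<phi> x \<le> 1" if "x \<in> topspace X" for x
    using pos [OF that] c(2) [OF that] d(2) [OF that] r(2) [OF that]
    by (simp add: \<phi>_def divide_simps)
  ultimately have "continuous_map X (top_of_set {0..1}) \<phi>"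
    by (auto simp: continuous_map_in_subtopology)
  then obtain \<Phi> where \<Phi>: "continuous_map ?B (top_of_set {0..1}) \<Phi>"
    and \<Phi>eq: "\<And>x. x \<in> topspace X \<Longrightarrow> \<Phi> (?e x) = \<phi> x"
    by (rule beta_space_extension) blast
  then have \<Phi>r: "continuous_map ?B euclideanreal \<Phi>"
    by (simp add: continuous_map_in_subtopology)
  have onC: "\<phi> x = 0" if "x \<in> C - E" for x
    using that Ceq Deq Eeq CDE(3) by (auto simp: \<phi>_def)
  have onD: "\<phi> x = 1" if "x \<in> D - E" for x
    using that Ceq Deq Eeq CDE(3) pos [of x] by (auto simp: \<phi>_def)
  have clE: "?B closure_of (?e ` E) \<subseteq> upsilon_set X"
    using pE pseudocompact_closure_of_Coz_iff [OF X CDE(4)] by blast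
  have closed: "closedin ?B {p \<in> topspace ?B. \<Phi> p \<in> S}" if "closed S" for S
    using closedin_continuous_map_preimage [OF \<Phi>r, of S] that by simp
  \<comment> \<open>The closure of the image of \<open>E\<close> misses \<open>?W\<close>, so a
    point of \<open>?W\<close> in the closure of the image of \<open>V\<close> is already approached
    from \<open>V - E\<close>.\<close>
  have val: "\<Phi> p \<in> S"
    if "closed S" "p \<in> ?W" "p \<in> ?B closure_of (?e ` V)" "V \<subseteq> topspace X"
      "\<And>x. x \<in> V - E \<Longrightarrow> \<phi> x \<in> S" for S p V
  proof -
    have "?e ` V \<subseteq> ?e ` (V - E) \<union> ?e ` E"
      by blast
    then have "p \<in> ?B closure_of (?e ` (V - E)) \<or> p \<in> ?B closure_of (?e ` E)"
      using that(3) closure_of_mono [of "?e ` V" "?e ` (V - E) \<union> ?e ` E" ?B] by auto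
    then have "p \<in> ?B closure_of (?e ` (V - E))"
      using that(2) clE by blast
    moreover have "\<Phi> q \<in> S" if "q \<in> ?e ` (V - E)" for q
      using that \<open>V \<subseteq> topspace X\<close> \<open>\<And>x. x \<in> V - E \<Longrightarrow> \<phi> x \<in> S\<close> \<Phi>eq by fastforce
    ultimately show ?thesis
      using forall_in_closure_of [of p ?B "?e ` (V - E)" "\<lambda>p. \<Phi> p \<in> S"] closed [OF that(1)] by blast
  qed
  have "\<Phi> p \<in> {0,1}" if "p \<in> ?W" for p
  proof (rule val [of _ _ "topspace X"])
    show "p \<in> ?B closure_of (?e ` topspace X)"
      using that by (simp add: dense_beta_space)
    show "\<phi> x \<in> {0,1}" if "x \<in> topspace X - E" for x
      using that cover onC [of x] onD [of x] by blast
  qed (use that in auto)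
  \<comment> \<open>The two values persist on the closure because \<open>{0,1}\<close> is
    closed.\<close>
  then have "\<Phi> p \<in> {0,1}" if "p \<in> ?K" for p
    using forall_in_closure_of [OF that, of "\<lambda>p. \<Phi> p \<in> {0,1}"] closed [of "{0,1}"]
    by (simp add: finite_imp_closed)
  then have "?K \<subseteq> {p \<in> topspace ?B. \<Phi> p \<in> {0}} \<union> {p \<in> topspace ?B. \<Phi> p \<in> {1}}"
    by (fastforce simp: in_closure_of)
  moreover have WK: "?W \<subseteq> ?K"
    by (rule closure_of_subset) blast
  \<comment> \<open>Non-pseudocompactness for \<open>C\<close> supplies a point of \<open>?W\<close>
    in the closure of its image, and \<open>val\<close> gives \<open>\<Phi>\<close> the value 0
    there.\<close>
  have "{p \<in> topspace ?B. \<Phi> p \<in> {0}} \<inter> ?K \<noteq> {}"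
  proof -
    obtain p where p: "p \<in> ?B closure_of (?e ` C)" "p \<notin> upsilon_set X"
      using npc(1) pseudocompact_closure_of_Coz_iff [OF X CDE(1)] by blast
    then have "p \<in> ?W"
      by (simp add: in_closure_of)
    moreover have "\<Phi> p \<in> {0}"
      by (rule val [OF _ \<open>p \<in> ?W\<close> p(1)]) (use onC Ceq in auto)
    ultimately show ?thesis
      using WK by blast
  qed
  moreover have "{p \<in> topspace ?B. \<Phi> p \<in> {1}} \<inter> ?K \<noteq> {}"
  proof -
    obtain p where p: "p \<in> ?B closure_of (?e ` D)" "p \<notin> upsilon_set X"
      using npc(2) pseudocompact_closure_of_Coz_iff [OF X CDE(2)] by blast
    then have "p \<in> ?W"
      by (simp add: in_closure_of)
    moreover have "\<Phi> p \<in> {1}"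
      by (rule val [OF _ \<open>p \<in> ?W\<close> p(1)]) (use onD Deq in auto)
    ultimately show ?thesis
      using WK by blast
  qed
  moreover have "{p \<in> topspace ?B. \<Phi> p \<in> {0}} \<inter> {p \<in> topspace ?B. \<Phi> p \<in> {1}} \<inter> ?K = {}"
    by auto
  ultimately show False
    using conn closed [of "{0}"] closed [of "{1}"] unfolding connectedin_closedin
    by (meson closed_singleton)
qed

section \<open>From a disconnection in \<beta>X to a separation of \<open>X\<close>\<close>

text \<open>Points outside \<upsilon>X come arbitrarily near \<open>p\<close>, so \<open>F\<close>
  is positive at one of them; by density of \<open>X\<close> in \<beta>X that point lies in the
  closure of the level set.\<close>

lemma not_pseudocompact_closure_of_level_set:
  fixes F :: "(('a \<Rightarrow> real) \<Rightarrow> real) \<Rightarrow> real"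
  assumes X: "completely_regular_space X" "Hausdorff_space X"
    and F: "continuous_map (beta_space X) euclideanreal F"
    and p: "p \<in> beta_space X closure_of (topspace (beta_space X) - upsilon_set X)" "0 < F p"
  shows "\<not> pseudocompact_space
    (subtopology X (X closure_of {x \<in> topspace X. 0 < F (beta_embed X x)}))"
proof -
  let ?B = "beta_space X" and ?e = "beta_embed X"
  let ?U = "{x \<in> topspace X. 0 < F (?e x)}"
  have "continuous_map X euclideanreal (\<lambda>x. F (?e x))"
    using continuous_map_compose [OF continuous_map_beta_embed F] by (simp add: o_def)
  then have U: "?U \<in> Coz X"
    by (rule positive_set_in_Coz)
  have op: "openin ?B {q \<in> topspace ?B. F q \<in> {0<..}}"
    by (intro openin_continuous_map_preimage [OF F]) simp
  moreover have "p \<in> {q \<in> topspace ?B. F q \<in> {0<..}}"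
    using p by (simp add: in_closure_of)
  ultimately obtain q where q: "q \<in> topspace ?B" "q \<notin> upsilon_set X" "0 < F q"
    using p(1) unfolding in_closure_of by (metis (mono_tags, lifting) DiffE greaterThan_iff mem_Collect_eq)
  have "q \<in> ?B closure_of (?e ` ?U)"
    unfolding in_closure_of
  proof (intro conjI allI impI)
    fix T
    assume T: "q \<in> T \<and> openin ?B T"
    \<comment> \<open>Shrinking \<open>T\<close> to the positive set of \<open>F\<close> forces the
      points of \<open>X\<close> found by density into the level set.\<close>
    then have "openin ?B (T \<inter> {q \<in> topspace ?B. F q \<in> {0<..}})"
      using op by blast
    moreover have "q \<in> ?B closure_of (?e ` topspace X)"
      using q(1) by (simp add: dense_beta_space)
    ultimately obtain y where "y \<in> ?e ` topspace X" "y \<in> T \<inter> {q \<in> topspace ?B. F q \<in> {0<..}}"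
      using q T unfolding in_closure_of by (metis (mono_tags, lifting) Int_iff greaterThan_iff mem_Collect_eq)
    then show "\<exists>y. y \<in> ?e ` ?U \<and> y \<in> T"
      by auto
  qed (fact q(1))
  then show ?thesis
    using q(2) pseudocompact_closure_of_Coz_iff [OF X U] by blast
qed

lemma not_connectedin_imp_P_separation:
  assumes X: "completely_regular_space X" "Hausdorff_space X"
    and "\<not> connectedin (beta_space X)
      (beta_space X closure_of (topspace (beta_space X) - upsilon_set X))"
  shows "\<exists>C D. P_separation pseudocompact_space X C D"
proof -
  let ?B = "beta_space X" and ?e = "beta_embed X"
  let ?W = "topspace ?B - upsilon_set X"
  let ?K = "?B closure_of ?W"
  obtain K0 K1 where K: "closedin ?B K0" "closedin ?B K1" "?K \<subseteq> K0 \<union> K1" "K0 \<inter> K1 \<inter> ?K = {}"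
    "K0 \<inter> ?K \<noteq> {}" "K1 \<inter> ?K \<noteq> {}"
    using assms(3) unfolding connectedin_closedin by (meson closure_of_subset_topspace)
  have "normal_space ?B"
    by (simp add: compact_Hausdorff_or_regular_imp_normal_space compact_space_beta_space
        Hausdorff_space_beta_space)
  \<comment> \<open>\<open>K0\<close> and \<open>K1\<close> are only known to be disjoint within
    \<open>?K\<close>, so Urysohn's lemma is applied to their traces on \<open>?K\<close>.\<close>
  moreover have "closedin ?B (K0 \<inter> ?K)" "closedin ?B (K1 \<inter> ?K)" "disjnt (K0 \<inter> ?K) (K1 \<inter> ?K)"
    using K by (auto simp: disjnt_def)
  ultimately obtain F where F: "continuous_map ?B (top_of_set {0..1::real}) F"
    "F ` (K0 \<inter> ?K) \<subseteq> {0}" "F ` (K1 \<inter> ?K) \<subseteq> {1}"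
    by (rule Urysohn_lemma [of ?B "K0 \<inter> ?K" "K1 \<inter> ?K" 0 1]) auto
  have Fr: "continuous_map ?B euclideanreal F"
    using F(1) by (simp add: continuous_map_in_subtopology)
  have Fe: "continuous_map X euclideanreal (\<lambda>x. F (?e x))"
    using continuous_map_compose [OF continuous_map_beta_embed Fr] by (simp add: o_def)
  have FK: "F p = 0 \<or> F p = 1" if "p \<in> ?K" for p
    using that F K(3) by blast
  \<comment> \<open>As \<open>1/4 < 1/3\<close> and \<open>2/3 < 3/4\<close>, the set
    \<open>E\<close> contains the gap between \<open>C\<close> and \<open>D\<close>, where
    \<open>F\<close> lies in \<open>[1/3, 2/3]\<close>, and still stays away from the values 0 and
    1.\<close>
  define C where "C = {x \<in> topspace X. 0 < 1/3 - F (?e x)}"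
  define D where "D = {x \<in> topspace X. 0 < F (?e x) - 2/3}"
  define E where "E = {x \<in> topspace X. 0 < min (F (?e x) - 1/4) (3/4 - F (?e x))}"
  have Coz: "C \<in> Coz X" "D \<in> Coz X" "E \<in> Coz X"
    unfolding C_def D_def E_def using Fe
    by (intro positive_set_in_Coz continuous_intros; simp)+
  have "C \<inter> D = {}" "topspace X - (C \<union> D) \<subseteq> E"
    by (auto simp: C_def D_def E_def)
  moreover have "\<not> pseudocompact_space (subtopology X (X closure_of C))"
  proof -
    obtain p where "p \<in> K0 \<inter> ?K"
      using K(5) by blast
    moreover have "continuous_map ?B euclideanreal (\<lambda>p. 1/3 - F p)"
      using Fr by (intro continuous_intros) auto
    ultimately show ?thesis
      using not_pseudocompact_closure_of_level_set [OF X, of "\<lambda>p. 1/3 - F p" p] F(2)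
      by (auto simp: C_def)
  qed
  moreover have "\<not> pseudocompact_space (subtopology X (X closure_of D))"
  proof -
    obtain p where "p \<in> K1 \<inter> ?K"
      using K(6) by blast
    moreover have "continuous_map ?B euclideanreal (\<lambda>p. F p - 2/3)"
      using Fr by (intro continuous_intros) auto
    ultimately show ?thesis
      using not_pseudocompact_closure_of_level_set [OF X, of "\<lambda>p. F p - 2/3" p] F(3)
      by (auto simp: D_def)
  qed
  moreover have "pseudocompact_space (subtopology X (X closure_of E))"
  proof -
    have closed: "closedin ?B {p \<in> topspace ?B. F p \<in> {1/4..3/4}}"
      by (intro closedin_continuous_map_preimage [OF Fr]) simp
    \<comment> \<open>On the closure of the image of \<open>E\<close> the function \<open>F\<close>
      stays in \<open>[1/4, 3/4]\<close>, while on \<open>?K\<close> it takes only the values 0 and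
      1.\<close>
    have "p \<in> upsilon_set X" if p: "p \<in> ?B closure_of (?e ` E)" for p
    proof (rule ccontr)
      assume "p \<notin> upsilon_set X"
      then have "p \<in> ?W"
        using p by (simp add: in_closure_of)
      then have "p \<in> ?K"
        using closure_of_subset [of ?W ?B] by blast
      moreover have "F p \<in> {1/4..3/4}"
        by (rule forall_in_closure_of [OF p _ closed]) (auto simp: E_def)
      ultimately show False
        using FK [of p] by auto
    qed
    then show ?thesis
      using pseudocompact_closure_of_Coz_iff [OF X Coz(3)] by blast
  qed
  ultimately show ?thesis
    unfolding P_separation_def using Coz by blast
qed

theorem theorem8p4:
  fixes X :: "'a topology"
  assumes "completely_regular_space X" and "Hausdorff_space X"
  shows "P_connected pseudocompact_space X \<longleftrightarrow>
         connectedin (beta_space X)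
           (beta_space X closure_of (topspace (beta_space X) - upsilon_set X))"
  using P_disconnected_imp_not_connectedin [OF assms] not_connectedin_imp_P_separation [OF assms]
  unfolding P_connected_def P_disconnected_def by blast

end
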